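(* Let $(X,y)\sim\mathcal{D}$ be a test example. For every $w\in\mathbb{R}^d$, the weak model $f_{wk}(w,\cdot)$ satisfies $$\mathbb{P}\big[\,y f_{wk}(w,X)<0 \;\big|\; (X,y)\in\mathcal{S}_h\,\big]=\tfrac12 .$$
   Context: Data distribution. Fix a dimension $d$, probabilities $p_e,p_h,p_b$ with $p_e+p_h+p_b=1$, a noise level $\sigma_p>0$, and mutually orthogonal signal vectors $\mu_1,\mu_{-1},\nu_1,\nu_{-1}\in\mathbb{R}^d$ with $\|\mu_1\|=\|\mu_{-1}\|=:\|\mu\|$ and $\|\nu_1\|=\|\nu_{-1}\|=:\|\nu\|$. The distribution $\mathcal{D}$ on $\mathbb{R}^{d\times 3}\times\{\pm1\}$ generates $(X,y)$ with $X=(x^{(1)},x^{(2)},x^{(3)})$ as follows. The label $y$ is uniform on $\{\pm1\}$. The pair of signal vectors $(v^{(1)},v^{(2)})$ equals $(\mu_y,\mu_y)$ with probability $p_e$ (easy-only data); is uniform on $\{(\nu_y,\nu_y),(\nu_y,-\nu_y),(-\nu_y,\nu_y),(-\nu_y,-\nu_y)\}$ with probability $p_h$ (hard-only data); is uniform on $\{(\mu_y,\nu_y),(\mu_y,-\nu_y),(\nu_y,\mu_y),(-\nu_y,\mu_y)\}$ with probability $p_b$ (both-signal data). Independently, the noise vector is $\xi\sim\mathcal{N}(0,\sigma_p^2\Lambda)$ with $\Lambda=I_d-\frac{\mu_1\mu_1^\top}{\|\mu\|^2}-\frac{\mu_{-1}\mu_{-1}^\top}{\|\mu\|^2}-\frac{\nu_1\nu_1^\top}{\|\nu\|^2}-\frac{\nu_{-1}\nu_{-1}^\top}{\|\nu\|^2}$.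 The patches $x^{(1)},x^{(2)},x^{(3)}$ are $v^{(1)},v^{(2)},\xi$ in a randomly shuffled order. $\mathcal{S}_e,\mathcal{S}_h,\mathcal{S}_b$ denote the supports of easy-only, hard-only and both-signal data, so conditioning on $(X,y)\in\mathcal{S}_h$ means conditioning on the example being hard-only. Weak model (linear CNN): for $w\in\mathbb{R}^d$, $f_{wk}(w,X)=\langle w,x^{(1)}\rangle+\langle w,x^{(2)}\rangle+\langle w,x^{(3)}\rangle$.
   Formalization: The claim is proved for w outside span{μ_1, μ_{-1}, ν_1, ν_{-1}}; for w in that span (e.g. w = 0) the noise term vanishes and the probability is at most 1/4, so "every w" fails. Also p_h > 0 and nonzero signals are assumed, so that all is defined. *)

theory Defs
  imports "HOL-Probability.Probability"
begin

text \<open>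
  Labels are the integers \<open>1\<close> and \<open>-1\<close>. A family of signals is a function \<open>mu\<close> (or \<open>nu\<close>) on labels,
  of which only the values at \<open>1\<close> and \<open>-1\<close> are used. The input \<open>X\<close> has type \<open>real^'n^3\<close>, so that
  \<open>X $ i\<close> is the \<open>i\<close>-th patch and \<open>CARD('n)\<close> is the dimension \<open>d\<close>.
\<close>

definition standard_gaussian :: "(real ^ 'n) measure" where
  "standard_gaussian = density lborel (\<lambda>z. ennreal (\<Prod>i\<in>UNIV. std_normal_density (z $ i)))"

text \<open>
  The possibly degenerate normal distribution \<open>N(m, S)\<close>, for positive semidefinite \<open>S\<close>, as the law
  of \<open>m + A Z\<close> with \<open>Z\<close> standard Gaussian and \<open>A A\<^sup>T = S\<close>. Such an \<open>A\<close> exists, and the law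
  does not depend on which one is chosen. If \<open>S\<close> is not positive semidefinite the value is
  meaningless.
\<close>
definition gaussian :: "real ^ 'n \<Rightarrow> real ^ 'n ^ 'n \<Rightarrow> (real ^ 'n) measure" where
  "gaussian m S =
     distr standard_gaussian borel
       (\<lambda>z. m + (SOME A :: real ^ 'n ^ 'n. A ** transpose A = S) *v z)"

definition outer :: "real ^ 'n \<Rightarrow> real ^ 'n \<Rightarrow> real ^ 'n ^ 'n" where
  "outer u v = (\<chi> i j. u $ i * v $ j)"

definition noise_shape ::
    "(int \<Rightarrow> real ^ 'n) \<Rightarrow> (int \<Rightarrow> real ^ 'n) \<Rightarrow> real ^ 'n ^ 'n" where
  "noise_shape mu nu =
     mat 1 - (1 / (norm (mu 1))\<^sup>2) *\<^sub>R outer (mu 1) (mu 1)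
           - (1 / (norm (mu (-1)))\<^sup>2) *\<^sub>R outer (mu (-1)) (mu (-1))
           - (1 / (norm (nu 1))\<^sup>2) *\<^sub>R outer (nu 1) (nu 1)
           - (1 / (norm (nu (-1)))\<^sup>2) *\<^sub>R outer (nu (-1)) (nu (-1))"

datatype kind = Easy_only | Hard_only | Both_signals

definition kind_pmf :: "real \<Rightarrow> real \<Rightarrow> real \<Rightarrow> kind pmf" where
  "kind_pmf p_e p_h p_b =
     embed_pmf (\<lambda>k. case k of Easy_only \<Rightarrow> p_e | Hard_only \<Rightarrow> p_h | Both_signals \<Rightarrow> p_b)"

definition signal_pmf ::
    "(int \<Rightarrow> real ^ 'n) \<Rightarrow> (int \<Rightarrow> real ^ 'n) \<Rightarrow> int \<Rightarrow> kind \<Rightarrow> ((real ^ 'n) \<times> (real ^ 'n)) pmf" where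
  "signal_pmf mu nu y k =
     (case k of
        Easy_only \<Rightarrow> return_pmf (mu y, mu y)
      | Hard_only \<Rightarrow> pmf_of_set {(nu y, nu y), (nu y, - nu y), (- nu y, nu y), (- nu y, - nu y)}
      | Both_signals \<Rightarrow> pmf_of_set {(mu y, nu y), (mu y, - nu y), (nu y, mu y), (- nu y, mu y)})"

text \<open>All the discrete randomness: kind, label, pair of signals, and order of the patches.\<close>
definition discrete_pmf ::
    "real \<Rightarrow> real \<Rightarrow> real \<Rightarrow> (int \<Rightarrow> real ^ 'n) \<Rightarrow> (int \<Rightarrow> real ^ 'n)
      \<Rightarrow> (kind \<times> int \<times> ((real ^ 'n) \<times> (real ^ 'n)) \<times> (3 \<Rightarrow> 3)) pmf" where
  "discrete_pmf p_e p_h p_b mu nu =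
     bind_pmf (kind_pmf p_e p_h p_b) (\<lambda>k.
     bind_pmf (pmf_of_set {1, -1}) (\<lambda>y.
     bind_pmf (signal_pmf mu nu y k) (\<lambda>v.
     bind_pmf (pmf_of_set {\<pi>. bij \<pi>}) (\<lambda>\<pi>.
     return_pmf (k, y, v, \<pi>)))))"

definition patches ::
    "(real ^ 'n) \<times> (real ^ 'n) \<Rightarrow> (3 \<Rightarrow> 3) \<Rightarrow> real ^ 'n \<Rightarrow> real ^ 'n ^ 3" where
  "patches v \<pi> \<xi> = (\<chi> i. (vector [fst v, snd v, \<xi>] :: real ^ 'n ^ 3) $ \<pi> i)"

text \<open>
  The joint law of the kind of an example and the example \<open>(X, y)\<close> itself; the distribution
  \<open>D\<close> of examples is its marginal on the last two components. The kind is kept so that one can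
  condition on an example being easy-only, hard-only or both-signal.
\<close>
definition data_dist ::
    "real \<Rightarrow> real \<Rightarrow> real \<Rightarrow> real \<Rightarrow> (int \<Rightarrow> real ^ 'n) \<Rightarrow> (int \<Rightarrow> real ^ 'n)
      \<Rightarrow> (kind \<times> (real ^ 'n ^ 3) \<times> int) measure" where
  "data_dist p_e p_h p_b \<sigma>\<^sub>p mu nu =
     distr (measure_pmf (discrete_pmf p_e p_h p_b mu nu)
              \<Otimes>\<^sub>M gaussian 0 (\<sigma>\<^sub>p\<^sup>2 *\<^sub>R noise_shape mu nu))
       (count_space UNIV \<Otimes>\<^sub>M (borel \<Otimes>\<^sub>M count_space UNIV))
       (\<lambda>((k, y, v, \<pi>), \<xi>). (k, patches v \<pi> \<xi>, y))"

definition f_wk :: "real ^ 'n \<Rightarrow> real ^ 'n ^ 3 \<Rightarrow> real" where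
  "f_wk w X = w \<bullet> (X $ 1) + w \<bullet> (X $ 2) + w \<bullet> (X $ 3)"

end

theory Submission
  imports Defs
begin

text \<open>
  A hard-only example with signals \<open>(v\<^sub>1, v\<^sub>2)\<close> gives \<open>y f_wk(w, X) = c + y \<langle>w, \<xi>\<rangle>\<close> with
  \<open>c = y \<langle>w, v\<^sub>1 + v\<^sub>2\<rangle>\<close>. The law of \<open>\<langle>w, \<xi>\<rangle>\<close> is symmetric, and it has no atoms because the
  noise covariance, a multiple of an orthogonal projection, does not annihilate \<open>w\<close>. Hence the
  error probabilities given \<open>c\<close> and \<open>-c\<close> add up to one, and the four sign patterns of the
  hard-only signals come in pairs with opposite \<open>c\<close>.
\<close>

section \<open>The standard Gaussian measure\<close>

lemma sets_standard_gaussian [simp, measurable_cong]: "sets standard_gaussian = sets borel"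
  and space_standard_gaussian [simp]: "space standard_gaussian = UNIV"
  by (simp_all add: standard_gaussian_def)

text \<open>The density is a product over the index type, whereas Fubini for \<open>lborel\<close>
  is stated over \<open>Basis\<close>. Reindexing along \<open>axis i 1\<close> connects the two and
  leaves a product of one-dimensional normal integrals.\<close>

lemma prob_space_standard_gaussian: "prob_space (standard_gaussian :: (real ^ 'n) measure)"
proof
  have Basis: "(Basis :: (real ^ 'n) set) = (\<lambda>i. axis i 1) ` UNIV"
    by (auto simp: Basis_vec_def)
  have inj: "inj (\<lambda>i. axis i (1::real) :: real ^ 'n)"
    by (auto simp: inj_on_def axis_eq_axis)
  have prod: "(\<Prod>i\<in>UNIV. std_normal_density (z $ i)) = (\<Prod>b\<in>Basis. std_normal_density (z \<bullet> b))"
    for z :: "real ^ 'n"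
    unfolding Basis by (subst prod.reindex[OF inj]) (simp add: inner_axis)
  have "emeasure (standard_gaussian :: (real ^ 'n) measure) UNIV =
      (\<integral>\<^sup>+z. (\<Prod>b\<in>Basis. ennreal (std_normal_density (z \<bullet> b))) \<partial>(lborel :: (real ^ 'n) measure))"
    unfolding standard_gaussian_def
    by (subst emeasure_density) (auto simp: prod prod_ennreal)
  also have "\<dots> = (\<Prod>b\<in>(Basis :: (real ^ 'n) set). \<integral>\<^sup>+x. ennreal (std_normal_density x) \<partial>lborel)"
    by (rule nn_integral_lborel_prod) auto
  also have "(\<integral>\<^sup>+x. ennreal (std_normal_density x) \<partial>lborel) = 1"
    using prob_space.emeasure_space_1[OF prob_space_normal_density[of 1 0]]
    by (simp add: emeasure_density)
  finally show "emeasure (standard_gaussian :: (real ^ 'n) measure) (space standard_gaussian) = 1"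
    by simp
qed

text \<open>Reflection preserves Lebesgue measure, and the density is even.\<close>

lemma distr_uminus_standard_gaussian:
  "distr standard_gaussian borel uminus = (standard_gaussian :: (real ^ 'n) measure)"
proof -
  have lborel: "distr lborel borel uminus = (lborel :: (real ^ 'n) measure)"
    by (subst (2) lborel_affine[of "-1" 0]) (auto simp: density_1)
  have "(standard_gaussian :: (real ^ 'n) measure) =
      density (distr lborel borel uminus) (\<lambda>z. ennreal (\<Prod>i\<in>UNIV. std_normal_density (z $ i)))"
    unfolding lborel standard_gaussian_def ..
  also have "\<dots> = distr standard_gaussian borel uminus"
    unfolding standard_gaussian_def
    by (subst density_distr) (auto simp: std_normal_density_def)
  finally show ?thesis ..
qed

text \<open>Hyperplanes are Lebesgue null, and the measure has a density with respect to
  \<open>lborel\<close>.\<close>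

lemma hyperplane_standard_gaussian:
  fixes u :: "real ^ 'n"
  assumes "u \<noteq> 0"
  shows "{z. u \<bullet> z = c} \<in> null_sets standard_gaussian"
proof -
  have "{z. u \<bullet> z = c} \<in> null_sets lebesgue"
    using assms by (simp flip: negligible_iff_null_sets add: negligible_hyperplane)
  moreover have "{z. u \<bullet> z = c} \<in> sets lborel"
    by simp
  ultimately have "{z. u \<bullet> z = c} \<in> null_sets lborel"
    by (simp add: null_sets_def)
  then show ?thesis
    unfolding standard_gaussian_def
    by (subst null_sets_density_iff) (auto dest: AE_not_in)
qed

section \<open>General Gaussian measures: symmetry and absence of atoms\<close>

text \<open>Names the choice made inside \<open>gaussian\<close>, so that it can be handled through
  its defining equation alone.\<close>

definition factor :: "real ^ 'n ^ 'n \<Rightarrow> real ^ 'n ^ 'n" where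
  "factor S = (SOME A. A ** transpose A = S)"

lemma factor:
  fixes A S :: "real ^ 'n ^ 'n"
  assumes "A ** transpose A = S"
  shows "factor S ** transpose (factor S) = S"
  unfolding factor_def using assms by (rule someI)

lemma gaussian_eq: "gaussian m S = distr standard_gaussian borel (\<lambda>z. m + factor S *v z)"
  by (simp add: gaussian_def factor_def)

lemma matrix_vector_mul_borel [measurable]:
  fixes A :: "real ^ 'n ^ 'm"
  shows "(\<lambda>z. A *v z) \<in> borel_measurable borel"
  by (intro borel_measurable_continuous_onI continuous_intros)

lemma sets_gaussian [simp, measurable_cong]: "sets (gaussian m S) = sets borel"
  and space_gaussian [simp]: "space (gaussian m S) = UNIV"
  by (simp_all add: gaussian_def)

lemma prob_space_gaussian: "prob_space (gaussian m S)"
  unfolding gaussian_eq by (intro prob_space.prob_space_distr prob_space_standard_gaussian) simp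

text \<open>A linear map commutes with negation, so the symmetry of the standard law passes to its
  image, whichever matrix \<open>factor S\<close> is.\<close>

lemma distr_uminus_gaussian: "distr (gaussian 0 S) borel uminus = gaussian 0 S"
proof -
  have "distr (gaussian 0 S) borel uminus =
      distr standard_gaussian borel (\<lambda>z. factor S *v (- z))"
    unfolding gaussian_eq
    by (subst distr_distr) (auto simp: o_def vec.neg)
  also have "\<dots> = distr (distr standard_gaussian borel uminus) borel (\<lambda>z. factor S *v z)"
    by (subst distr_distr) (auto simp: o_def)
  finally show ?thesis
    by (simp add: distr_uminus_standard_gaussian gaussian_eq)
qed

text \<open>The law may be degenerate, so some hyperplanes can carry mass. Pulled back along
  \<open>factor S\<close>, the hyperplane with normal \<open>w\<close> becomes the one with normal
  \<open>u = transpose (factor S) *v w\<close>, and \<open>u\<close> is nonzero because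
  \<open>factor S\<close> sends it to \<open>S *v w\<close>.\<close>

lemma hyperplane_gaussian:
  fixes A S :: "real ^ 'n ^ 'n" and w :: "real ^ 'n"
  assumes "A ** transpose A = S" and "S *v w \<noteq> 0"
  shows "{\<xi>. w \<bullet> \<xi> = c} \<in> null_sets (gaussian 0 S)"
proof -
  define u where "u = transpose (factor S) *v w"
  have "factor S *v u = S *v w"
    by (simp only: u_def matrix_vector_mul_assoc factor[OF assms(1)])
  then have "u \<noteq> 0"
    using assms(2) by auto
  have "w \<bullet> (factor S *v z) = u \<bullet> z" for z
    by (simp add: u_def dot_lmul_matrix)
  then have "emeasure (gaussian 0 S) {\<xi>. w \<bullet> \<xi> = c} = emeasure standard_gaussian {z. u \<bullet> z = c}"
    unfolding gaussian_eq by (subst emeasure_distr) (auto simp: vimage_def)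
  then show ?thesis
    using hyperplane_standard_gaussian[OF \<open>u \<noteq> 0\<close>, of c] by (auto simp: null_sets_def)
qed

lemma measure_gaussian_uminus:
  assumes "B \<in> sets borel"
  shows "measure (gaussian 0 S) {\<xi>. - \<xi> \<in> B} = measure (gaussian 0 S) B"
proof -
  have "measure (gaussian 0 S) B = measure (distr (gaussian 0 S) borel uminus) B"
    by (simp only: distr_uminus_gaussian)
  also have "\<dots> = measure (gaussian 0 S) {\<xi>. - \<xi> \<in> B}"
    using assms by (subst measure_distr) (auto simp: vimage_def)
  finally show ?thesis ..
qed

text \<open>Reflection turns the second halfspace into \<open>c < w \<bullet> \<xi>\<close>, which
  is the complement of the first up to a null hyperplane.\<close>

lemma gaussian_halfspaces:
  fixes A S :: "real ^ 'n ^ 'n" and w :: "real ^ 'n"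
  assumes "A ** transpose A = S" and "S *v w \<noteq> 0"
  shows "measure (gaussian 0 S) {\<xi>. w \<bullet> \<xi> < c} + measure (gaussian 0 S) {\<xi>. w \<bullet> \<xi> < - c} = 1"
proof -
  interpret prob_space "gaussian 0 S" by (rule prob_space_gaussian)
  have "prob {\<xi>. w \<bullet> \<xi> < - c} = prob {\<xi>. c < w \<bullet> \<xi>}"
    using measure_gaussian_uminus[of "{\<xi>. c < w \<bullet> \<xi>}" S] by (simp add: less_minus_iff)
  also have "\<dots> = prob ({\<xi>. c < w \<bullet> \<xi>} \<union> {\<xi>. w \<bullet> \<xi> = c})"
    by (rule measure_Un_null_set[symmetric]) (use hyperplane_gaussian[OF assms] in auto)
  also have "{\<xi>. c < w \<bullet> \<xi>} \<union> {\<xi>. w \<bullet> \<xi> = c} = space (gaussian 0 S) - {\<xi>. w \<bullet> \<xi> < c}"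
    by auto
  also have "prob \<dots> = 1 - prob {\<xi>. w \<bullet> \<xi> < c}"
    by (rule prob_compl) simp
  finally show ?thesis by simp
qed

section \<open>The noise covariance as an orthogonal projection\<close>

lemma outer_vector_mul: "outer u v *v x = (v \<bullet> x) *\<^sub>R u"
  by (simp add: outer_def matrix_vector_mult_def vec_eq_iff inner_vec_def sum_distrib_left sum_distrib_right algebra_simps)

lemma matrix_mult_scaleR:
  fixes A :: "real ^ 'n ^ 'm" and B :: "real ^ 'k ^ 'n"
  shows "(c *\<^sub>R A) ** B = c *\<^sub>R (A ** B)" and "A ** (c *\<^sub>R B) = c *\<^sub>R (A ** B)"
  by (simp_all add: matrix_matrix_mult_def vec_eq_iff sum_distrib_left mult.left_commute mult.assoc)

lemma transpose_noise_shape: "transpose (noise_shape mu nu) = noise_shape mu nu"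
  by (simp add: noise_shape_def transpose_def vec_eq_iff outer_def mat_def mult.commute)

lemma noise_shape_vector_mul:
  "noise_shape mu nu *v x =
     x - ((mu 1 \<bullet> x) / (norm (mu 1))\<^sup>2) *\<^sub>R mu 1 - ((mu (-1) \<bullet> x) / (norm (mu (-1)))\<^sup>2) *\<^sub>R mu (-1)
       - ((nu 1 \<bullet> x) / (norm (nu 1))\<^sup>2) *\<^sub>R nu 1 - ((nu (-1) \<bullet> x) / (norm (nu (-1)))\<^sup>2) *\<^sub>R nu (-1)"
  by (simp add: noise_shape_def matrix_vector_mult_diff_rdistrib scaleR_matrix_vector_assoc[symmetric] outer_vector_mul)

text \<open>Every vector in the image of the matrix is orthogonal to all four signals, so a second
  application subtracts nothing.\<close>

lemma noise_shape_idempotent: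
  fixes mu nu :: "int \<Rightarrow> real ^ 'n"
  assumes "mu 1 \<bullet> mu (-1) = 0" and "nu 1 \<bullet> nu (-1) = 0"
    and "\<And>y y'. y \<in> {1, -1} \<Longrightarrow> y' \<in> {1, -1} \<Longrightarrow> mu y \<bullet> nu y' = 0"
  shows "noise_shape mu nu ** noise_shape mu nu = noise_shape mu nu"
proof -
  have orth: "mu 1 \<bullet> nu 1 = 0" "mu 1 \<bullet> nu (-1) = 0" "mu (-1) \<bullet> nu 1 = 0" "mu (-1) \<bullet> nu (-1) = 0"
    using assms(3) by auto
  have "u \<bullet> (noise_shape mu nu *v x) = 0" if "u \<in> {mu 1, mu (-1), nu 1, nu (-1)}" for u x
    using that orth assms(1,2)
    by (auto simp: noise_shape_vector_mul inner_diff_right power2_norm_eq_inner inner_commute)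
  then have "noise_shape mu nu *v (noise_shape mu nu *v x) = noise_shape mu nu *v x" for x
    by (subst noise_shape_vector_mul) simp
  then show ?thesis
    by (simp add: matrix_eq matrix_vector_mul_assoc)
qed

text \<open>A vector sent to zero equals the sum of its projections onto the signals, which is an
  explicit linear combination of them.\<close>

lemma noise_shape_kernel:
  assumes "noise_shape mu nu *v w = 0"
  shows "w \<in> span {mu 1, mu (-1), nu 1, nu (-1)}" (is "w \<in> span ?B")
proof -
  have "w = ((mu 1 \<bullet> w) / (norm (mu 1))\<^sup>2) *\<^sub>R mu 1 + ((mu (-1) \<bullet> w) / (norm (mu (-1)))\<^sup>2) *\<^sub>R mu (-1)
       + ((nu 1 \<bullet> w) / (norm (nu 1))\<^sup>2) *\<^sub>R nu 1 + ((nu (-1) \<bullet> w) / (norm (nu (-1)))\<^sup>2) *\<^sub>R nu (-1)"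
    (is "_ = ?r")
    using assms by (simp add: noise_shape_vector_mul algebra_simps)
  moreover have "?r \<in> span ?B"
    by (intro span_add span_scale span_base) auto
  ultimately show ?thesis by metis
qed

section \<open>The model output and integration against the data distribution\<close>

text \<open>The weak model sums over the patches symmetrically, so the shuffle drops out.\<close>

lemma f_wk_patches:
  fixes w :: "real ^ 'n"
  assumes "bij \<pi>"
  shows "f_wk w (patches v \<pi> \<xi>) = w \<bullet> fst v + w \<bullet> snd v + w \<bullet> \<xi>"
proof -
  let ?x = "vector [fst v, snd v, \<xi>] :: real ^ 'n ^ 3"
  have "f_wk w (patches v \<pi> \<xi>) = (\<Sum>i\<in>UNIV. w \<bullet> ?x $ \<pi> i)"
    by (simp add: f_wk_def patches_def sum_3)
  also have "\<dots> = (\<Sum>i\<in>UNIV. w \<bullet> ?x $ i)"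
    by (rule sum.reindex_bij_betw) (use assms in simp)
  finally show ?thesis
    by (simp add: sum_3)
qed

lemma pmf_kind:
  assumes "p_e \<ge> 0" "p_h \<ge> 0" "p_b \<ge> 0" "p_e + p_h + p_b = 1"
  shows "pmf (kind_pmf p_e p_h p_b) Hard_only = p_h"
proof -
  have UNIV: "(UNIV :: kind set) = {Easy_only, Hard_only, Both_signals}"
    using kind.exhaust by auto
  have "finite (UNIV :: kind set)" by (simp add: UNIV)
  show ?thesis unfolding kind_pmf_def
  proof (subst pmf_embed_pmf)
    show "(\<integral>\<^sup>+k. ennreal (case k of Easy_only \<Rightarrow> p_e | Hard_only \<Rightarrow> p_h | Both_signals \<Rightarrow> p_b) \<partial>count_space UNIV) = 1"
      using assms by (subst nn_integral_count_space_finite[OF \<open>finite _\<close>])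
        (auto simp: UNIV add.assoc simp flip: ennreal_plus)
  qed (use assms in \<open>auto split: kind.split\<close>)
qed

text \<open>Everything is measurable in the discrete component, and the noise enters by a
  projection. A patch is selected among three measurable vectors according to the value of the
  permutation, and measurability is checked coordinate by coordinate.\<close>

lemma measurable_patches [measurable]:
  fixes D :: "(kind \<times> int \<times> ((real ^ 'n) \<times> (real ^ 'n)) \<times> (3 \<Rightarrow> 3)) pmf"
  shows "(\<lambda>((k, y, v, \<pi>), \<xi>). (k, patches v \<pi> \<xi>, y)) \<in>
     measure_pmf D \<Otimes>\<^sub>M gaussian m S \<rightarrow>\<^sub>M count_space UNIV \<Otimes>\<^sub>M (borel \<Otimes>\<^sub>M count_space UNIV)"
proof -
  let ?M = "measure_pmf D \<Otimes>\<^sub>M gaussian m S"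
  let ?v = "\<lambda>\<omega>. fst (snd (snd (fst \<omega>)))" and ?\<pi> = "\<lambda>\<omega>. snd (snd (snd (fst \<omega>)))"
  have discrete: "(\<lambda>\<omega>. h (fst \<omega>)) \<in> ?M \<rightarrow>\<^sub>M N" if "\<And>d. h d \<in> space N" for h and N :: "'z measure"
    by (rule measurable_compose[OF measurable_fst]) (use that in auto)
  have noise [measurable]: "snd \<in> borel_measurable ?M"
    using measurable_snd[of "measure_pmf D" "gaussian m S"] by (simp cong: measurable_cong_sets)
  have fst_v [measurable]: "(\<lambda>\<omega>. fst (?v \<omega>)) \<in> borel_measurable ?M"
    by (rule discrete) simp
  have snd_v [measurable]: "(\<lambda>\<omega>. snd (?v \<omega>)) \<in> borel_measurable ?M"
    by (rule discrete) simp
  have pred [measurable]: "Measurable.pred ?M (\<lambda>\<omega>. ?\<pi> \<omega> i = j)" for i j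
    by (rule discrete) simp
  have "(\<lambda>\<omega>. patches (?v \<omega>) (?\<pi> \<omega>) (snd \<omega>) $ i $ j) \<in> borel_measurable ?M" for i j
  proof -
    have "patches (?v \<omega>) (?\<pi> \<omega>) (snd \<omega>) $ i =
        (if ?\<pi> \<omega> i = 1 then fst (?v \<omega>) else if ?\<pi> \<omega> i = 2 then snd (?v \<omega>) else snd \<omega>)"
      for \<omega> :: "(kind \<times> int \<times> ((real ^ 'n) \<times> (real ^ 'n)) \<times> (3 \<Rightarrow> 3)) \<times> (real ^ 'n)"
      using exhaust_3[of "?\<pi> \<omega> i"] by (auto simp: patches_def)
    then show ?thesis
      by (simp add: cart_eq_inner_axis)
  qed
  then have [measurable]: "(\<lambda>\<omega>. patches (?v \<omega>) (?\<pi> \<omega>) (snd \<omega>)) \<in> borel_measurable ?M"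
    by (subst borel_measurable_euclidean_space) (auto simp: Basis_vec_def inner_axis)
  have [measurable]: "(\<lambda>\<omega>. fst (fst \<omega>)) \<in> ?M \<rightarrow>\<^sub>M count_space UNIV"
    "(\<lambda>\<omega>. fst (snd (fst \<omega>))) \<in> ?M \<rightarrow>\<^sub>M count_space UNIV"
    by (rule discrete, simp)+
  show ?thesis
    unfolding case_prod_beta by measurable
qed

text \<open>The noise is independent of the discrete part, so by Fubini the probability is the
  average of the Gaussian measures of the sections; unfolding the nested \<open>bind_pmf\<close>
  splits this average into four integrals. A general \<open>P\<close> serves both the numerator and
  the denominator of the conditional probability.\<close>

lemma emeasure_data_dist:
  fixes P :: "kind \<Rightarrow> real ^ 'n ^ 3 \<Rightarrow> int \<Rightarrow> bool"
  assumes [measurable]: "Measurable.pred (count_space UNIV \<Otimes>\<^sub>M (borel \<Otimes>\<^sub>M count_space UNIV)) (\<lambda>(k, X, y). P k X y)"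
  shows "emeasure (data_dist p_e p_h p_b \<sigma>\<^sub>p mu nu) {(k, X, y). P k X y} =
    (\<integral>\<^sup>+k. \<integral>\<^sup>+y. \<integral>\<^sup>+v. \<integral>\<^sup>+\<pi>. emeasure (gaussian 0 (\<sigma>\<^sub>p\<^sup>2 *\<^sub>R noise_shape mu nu)) {\<xi>. P k (patches v \<pi> \<xi>) y}
      \<partial>pmf_of_set {\<pi>. bij \<pi>} \<partial>signal_pmf mu nu y k \<partial>pmf_of_set {1, -1} \<partial>kind_pmf p_e p_h p_b)"
proof -
  let ?G = "gaussian 0 (\<sigma>\<^sub>p\<^sup>2 *\<^sub>R noise_shape mu nu)" and ?D = "discrete_pmf p_e p_h p_b mu nu"
  let ?N = "count_space UNIV \<Otimes>\<^sub>M (borel \<Otimes>\<^sub>M count_space UNIV) :: (kind \<times> (real ^ 'n ^ 3) \<times> int) measure"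
  let ?T = "\<lambda>((k, y, v, \<pi>), \<xi>). (k, patches v \<pi> \<xi>, y)"
  interpret G: prob_space ?G by (rule prob_space_gaussian)
  have sets: "{(k, X, y). P k X y} \<in> sets ?N"
    using assms by (simp add: pred_def space_pair_measure)
  have vimage: "?T -` {(k, X, y). P k X y} \<in> sets (measure_pmf ?D \<Otimes>\<^sub>M ?G)"
    using measurable_sets[OF measurable_patches sets, of ?D 0 "\<sigma>\<^sub>p\<^sup>2 *\<^sub>R noise_shape mu nu"]
    by (simp add: space_pair_measure)
  have "emeasure (data_dist p_e p_h p_b \<sigma>\<^sub>p mu nu) {(k, X, y). P k X y} =
      emeasure (measure_pmf ?D \<Otimes>\<^sub>M ?G) (?T -` {(k, X, y). P k X y})"
    unfolding data_dist_def
    by (subst emeasure_distr[OF measurable_patches sets]) (simp add: space_pair_measure)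
  also have "\<dots> = (\<integral>\<^sup>+d. emeasure ?G (Pair d -` ?T -` {(k, X, y). P k X y}) \<partial>?D)"
    by (rule G.emeasure_pair_measure_alt[OF vimage])
  finally show ?thesis
    by (simp add: discrete_pmf_def vimage_def case_prod_beta)
qed

section \<open>The error probability on hard-only data\<close>

theorem proposition2p1:
  fixes mu nu :: "int \<Rightarrow> real ^ 'n"
    and w :: "real ^ 'n"
    and p_e p_h p_b \<sigma>\<^sub>p :: real
  assumes "p_e \<ge> 0" and "p_h > 0" and "p_b \<ge> 0" and "p_e + p_h + p_b = 1"
    and "\<sigma>\<^sub>p > 0"
    and "mu 1 \<noteq> 0" and "nu 1 \<noteq> 0"
    and "norm (mu 1) = norm (mu (-1))" and "norm (nu 1) = norm (nu (-1))"
    and "mu 1 \<bullet> mu (-1) = 0" and "nu 1 \<bullet> nu (-1) = 0"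
    and "\<And>y y'. y \<in> {1, -1} \<Longrightarrow> y' \<in> {1, -1} \<Longrightarrow> mu y \<bullet> nu y' = 0"
    and "w \<notin> span {mu 1, mu (-1), nu 1, nu (-1)}"
  shows "\<P>((k, X, y) in data_dist p_e p_h p_b \<sigma>\<^sub>p mu nu.
            of_int y * f_wk w X < 0 \<bar> k = Hard_only) = 1 / 2"
proof -
  let ?L = "noise_shape mu nu"
  define G where "G = gaussian 0 (\<sigma>\<^sub>p\<^sup>2 *\<^sub>R ?L)"
  interpret G: prob_space G
    unfolding G_def by (rule prob_space_gaussian)
  have [simp]: "sets G = sets borel" "space G = UNIV"
    by (simp_all add: G_def)
  let ?D = "data_dist p_e p_h p_b \<sigma>\<^sub>p mu nu"
  let ?K = "kind_pmf p_e p_h p_b"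
  \<comment> \<open>The strict distribution function of the noise contribution
    \<open>w \<bullet> \<xi>\<close>.\<close>
  define F where "F c = measure G {\<xi>. w \<bullet> \<xi> < c}" for c
  \<comment> \<open>A symmetric idempotent is its own square root; this supplies the factorization
    on which \<open>gaussian\<close> depends.\<close>
  have root: "(\<sigma>\<^sub>p *\<^sub>R ?L) ** transpose (\<sigma>\<^sub>p *\<^sub>R ?L) = \<sigma>\<^sub>p\<^sup>2 *\<^sub>R ?L"
  proof -
    have "transpose (\<sigma>\<^sub>p *\<^sub>R ?L) = \<sigma>\<^sub>p *\<^sub>R ?L"
      by (simp add: transpose_scalar transpose_noise_shape)
    then show ?thesis
      using noise_shape_idempotent[of mu nu] assms(10-12)
      by (simp add: matrix_mult_scaleR power2_eq_square)
  qed
  \<comment> \<open>Here \<open>w\<close> lying outside the span is used. For \<open>w\<close> in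
    the span the noise contribution would vanish almost surely, and the sign patterns with total
    signal zero would give ties, which are not errors.\<close>
  have nonzero: "(\<sigma>\<^sub>p\<^sup>2 *\<^sub>R ?L) *v w \<noteq> 0"
    using noise_shape_kernel[of mu nu w] assms(5,13)
    by (auto simp: scaleR_matrix_vector_assoc[symmetric])
  have F: "F c + F (- c) = 1" for c
    unfolding F_def G_def by (rule gaussian_halfspaces[OF root nonzero])
  \<comment> \<open>For \<open>y = 1\<close> this rearranges the inequality; for
    \<open>y = -1\<close> the event is an upper halfspace, which reflection turns into a lower
    one.\<close>
  have wrong: "emeasure G {\<xi>. of_int y * (c + w \<bullet> \<xi>) < 0} = ennreal (F (- of_int y * c))"
    if "y \<in> {1, -1}" for y :: int and c
  proof -
    have "measure G {\<xi>. - c < w \<bullet> \<xi>} = F c"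
      using measure_gaussian_uminus[of "{\<xi>. w \<bullet> \<xi> < c}" "\<sigma>\<^sub>p\<^sup>2 *\<^sub>R ?L"]
      by (simp add: F_def G_def minus_less_iff)
    moreover have "measure G {\<xi>. c + w \<bullet> \<xi> < 0} = F (- c)"
      unfolding F_def by (rule arg_cong[where f = "measure G"]) auto
    ultimately show ?thesis
      using that by (auto simp: G.emeasure_eq_measure)
  qed
  have given_v: "(\<integral>\<^sup>+\<pi>. emeasure G {\<xi>. of_int y * f_wk w (patches v \<pi> \<xi>) < 0} \<partial>pmf_of_set {\<pi>. bij \<pi>})
      = ennreal (F (- of_int y * (w \<bullet> fst v + w \<bullet> snd v)))"
    if "y \<in> {1, -1}" for y v
  proof -
    \<comment> \<open>The set of permutations must be known to be nonempty before
      \<open>pmf_of_set\<close> is known to be supported on it.\<close>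
    have "bij (id :: 3 \<Rightarrow> 3)" by simp
    then have "{\<pi> :: 3 \<Rightarrow> 3. bij \<pi>} \<noteq> {}" by blast
    then have "AE \<pi> in pmf_of_set {\<pi> :: 3 \<Rightarrow> 3. bij \<pi>}. bij \<pi>"
      by (simp add: AE_measure_pmf_iff)
    then have "(\<integral>\<^sup>+\<pi>. emeasure G {\<xi>. of_int y * f_wk w (patches v \<pi> \<xi>) < 0} \<partial>pmf_of_set {\<pi>. bij \<pi>}) =
        (\<integral>\<^sup>+\<pi>. ennreal (F (- of_int y * (w \<bullet> fst v + w \<bullet> snd v))) \<partial>pmf_of_set {\<pi> :: 3 \<Rightarrow> 3. bij \<pi>})"
      by (intro nn_integral_cong_AE) (auto simp: f_wk_patches wrong[OF that])
    then show ?thesis by simp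
  qed
  have given_y: "(\<integral>\<^sup>+v. ennreal (F (- of_int y * (w \<bullet> fst v + w \<bullet> snd v))) \<partial>signal_pmf mu nu y Hard_only)
      = ennreal (1 / 2)" if "y \<in> {1, -1}" for y
  proof -
    have "nu y \<noteq> 0"
      using that assms(7,9) by (metis insertE norm_eq_zero singletonD)
    \<comment> \<open>This makes the four sign patterns distinct, so that each has probability
      \<open>1 / 4\<close>.\<close>
    have neq: "nu y \<noteq> - nu y"
    proof
      assume "nu y = - nu y"
      then have "2 *\<^sub>R nu y = 0"
        by (metis add.right_inverse scaleR_2)
      with \<open>nu y \<noteq> 0\<close> show False by simp
    qed
    \<comment> \<open>The argument of \<open>F\<close> for the pattern \<open>(nu y, nu y)\<close>.
      The pattern with both signs flipped gives \<open>- c\<close>, and the two mixed patterns give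
      \<open>0\<close>.\<close>
    define c where "c = - of_int y * (2 * (w \<bullet> nu y))"
    have nonneg: "F b \<ge> 0" for b
      by (simp add: F_def)
    have "(\<integral>\<^sup>+v. ennreal (F (- of_int y * (w \<bullet> fst v + w \<bullet> snd v))) \<partial>signal_pmf mu nu y Hard_only) =
        (ennreal (F c) + (ennreal (F 0) + (ennreal (F 0) + ennreal (F (- c))))) / 4"
      by (simp add: signal_pmf_def nn_integral_pmf_of_set neq neq[symmetric] c_def algebra_simps)
    also have "\<dots> = ennreal ((F c + (F 0 + (F 0 + F (- c)))) / 4)"
      by (simp add: nonneg ennreal_divide_numeral flip: ennreal_plus)
    \<comment> \<open>The equal-sign patterns contribute \<open>F c + F (- c) = 1\<close>, and the
      mixed ones \<open>F 0 + F 0 = 1\<close>.\<close>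
    also have "F c + (F 0 + (F 0 + F (- c))) = 2"
      using F[of c] F[of 0] by simp
    finally show ?thesis by simp
  qed
  have hard: "emeasure ?K {Hard_only} = ennreal p_h"
    using pmf_kind[of p_e p_h p_b] assms(1-4) by (simp add: emeasure_pmf_single)
  have f_wk [measurable]: "f_wk w \<in> borel_measurable borel"
    unfolding f_wk_def by (intro borel_measurable_continuous_onI continuous_intros)
  have "emeasure ?D {(k, X, y). of_int y * f_wk w X < 0 \<and> k = Hard_only} =
      (\<integral>\<^sup>+k. \<integral>\<^sup>+y. \<integral>\<^sup>+v. \<integral>\<^sup>+\<pi>. emeasure G {\<xi>. of_int y * f_wk w (patches v \<pi> \<xi>) < 0 \<and> k = Hard_only}
        \<partial>pmf_of_set {\<pi>. bij \<pi>} \<partial>signal_pmf mu nu y k \<partial>pmf_of_set {1, -1} \<partial>?K)"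
    unfolding G_def by (rule emeasure_data_dist) measurable
  \<comment> \<open>For any other kind the event is empty; for the hard-only kind the inner
    integrals give one half for either label.\<close>
  also have "\<dots> = (\<integral>\<^sup>+k. ennreal (1 / 2) * indicator {Hard_only} k \<partial>?K)"
  proof (rule nn_integral_cong)
    fix k
    show "(\<integral>\<^sup>+y. \<integral>\<^sup>+v. \<integral>\<^sup>+\<pi>. emeasure G {\<xi>. of_int y * f_wk w (patches v \<pi> \<xi>) < 0 \<and> k = Hard_only}
        \<partial>pmf_of_set {\<pi>. bij \<pi>} \<partial>signal_pmf mu nu y k \<partial>pmf_of_set {1, -1}) =
      ennreal (1 / 2) * indicator {Hard_only} k"
    proof (cases "k = Hard_only")
      case True
      have "(\<integral>\<^sup>+y. \<integral>\<^sup>+v. \<integral>\<^sup>+\<pi>. emeasure G {\<xi>. of_int y * f_wk w (patches v \<pi> \<xi>) < 0}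
          \<partial>pmf_of_set {\<pi>. bij \<pi>} \<partial>signal_pmf mu nu y Hard_only \<partial>pmf_of_set {1, -1}) =
        (\<integral>\<^sup>+y. ennreal (1 / 2) \<partial>pmf_of_set {1, -1 :: int})"
      \<comment> \<open>The inner value is known only for labels in the support, so equality is
        required only almost everywhere.\<close>
      proof (intro nn_integral_cong_AE, subst AE_measure_pmf_iff, rule ballI)
        fix y :: int
        assume "y \<in> set_pmf (pmf_of_set {1, -1})"
        then have y: "y \<in> {1, -1}"
          by simp
        show "(\<integral>\<^sup>+v. \<integral>\<^sup>+\<pi>. emeasure G {\<xi>. of_int y * f_wk w (patches v \<pi> \<xi>) < 0}
            \<partial>pmf_of_set {\<pi>. bij \<pi>} \<partial>signal_pmf mu nu y Hard_only) = ennreal (1 / 2)"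
          by (simp only: given_v[OF y] given_y[OF y])
      qed
      with True show ?thesis
        by simp
    qed simp
  qed
  also have "\<dots> = ennreal (1 / 2) * ennreal p_h"
    by (simp add: nn_integral_cmult hard)
  also have "\<dots> = ennreal (p_h / 2)"
    using assms(2) by (subst ennreal_mult[symmetric]) auto
  finally have num: "measure ?D {(k, X, y). of_int y * f_wk w X < 0 \<and> k = Hard_only} = p_h / 2"
    using assms(2) by (simp add: measure_def)
  \<comment> \<open>The conditioning event is treated by the same disintegration, with a predicate
    that ignores the noise.\<close>
  have "emeasure ?D {(k, X, y). k = Hard_only} =
      (\<integral>\<^sup>+k. \<integral>\<^sup>+y. \<integral>\<^sup>+v. \<integral>\<^sup>+\<pi>. emeasure G {\<xi>. k = Hard_only}
        \<partial>pmf_of_set {\<pi> :: 3 \<Rightarrow> 3. bij \<pi>} \<partial>signal_pmf mu nu y k \<partial>pmf_of_set {1, -1} \<partial>?K)"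
    unfolding G_def by (rule emeasure_data_dist) measurable
  also have "\<dots> = (\<integral>\<^sup>+k. indicator {Hard_only} k \<partial>?K)"
  proof (rule nn_integral_cong)
    show "(\<integral>\<^sup>+y. \<integral>\<^sup>+v. \<integral>\<^sup>+\<pi>. emeasure G {\<xi>. k = Hard_only}
        \<partial>pmf_of_set {\<pi> :: 3 \<Rightarrow> 3. bij \<pi>} \<partial>signal_pmf mu nu y k \<partial>pmf_of_set {1, -1}) =
      indicator {Hard_only} k" for k
      using G.emeasure_space_1 by (cases "k = Hard_only") simp_all
  qed
  also have "\<dots> = ennreal p_h"
    by (simp add: hard)
  finally have den: "measure ?D {(k, X, y). k = Hard_only} = p_h"
    using assms(2) by (simp add: measure_def)
  \<comment> \<open>\<open>cond_prob\<close> restricts its events to the space of the measure; here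
    this restriction is vacuous.\<close>
  have "space ?D = UNIV"
    by (simp add: data_dist_def space_pair_measure)
  then show ?thesis
    using num den assms(2) by (simp add: cond_prob_def case_prod_unfold)
qed

end
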